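(* Let $\mathcal{E}=(V,\langle\cdot,\cdot\rangle)$ be a finite dimensional real inner product space and let $X$ be a centered random vector in $\mathcal{E}$ with positive definite covariance $\Sigma$. Let $T$ be a non-empty Borel subset of $V$ and let $b\in V$, $b\neq 0$. Then, for all $u\in\mathfrak{b}(T)$, $$\Pr\{X\in T\}\leq \frac{\langle u,\Sigma(u)\rangle}{1+\langle u,\Sigma(u)\rangle}.$$ Therefore, if $\mathfrak{b}(T)$ is non-empty, then $$\Pr\{X\in T\}\leq \inf_{u\in \mathfrak{b}(T)}\frac{\langle u,\Sigma(u)\rangle}{1+\langle u,\Sigma(u)\rangle}.$$ If $T$ is a closed convex set such that $0\notin T$, then the latter bound is sharp, in the sense that there exists a centered random vector $X_0$ in $\mathcal{E}$ with covariance $\Sigma$ such that $$\Pr\{X_0\in T\}= \inf_{u\in \mathfrak{b}(T)}\frac{\langle u,\Sigma(u)\rangle}{1+\langle u,\Sigma(u)\rangle}.$$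
   Context: A random vector in $\mathcal{E}=(V,\langle\cdot,\cdot\rangle)$ is a measurable map $X$ from a probability space to $V$ equipped with its Borel $\sigma$-algebra. It is centered if $\mathbb{E}(\langle v,X\rangle)=0$ for all $v\in V$. If $\langle u,X\rangle$ has finite variance for every $u\in V$, the covariance of a centered random vector $X$ is the unique positive semi-definite self-adjoint endomorphism $\Sigma$ of $V$ with $\mathbb{E}(\langle u,X\rangle\langle v,X\rangle)=\langle u,\Sigma(v)\rangle$ for all $u,v\in V$; it is positive definite if $\langle u,\Sigma(u)\rangle>0$ for all $u\neq0$. For $T\subseteq V$, the blocker of $T$ in $\mathcal{E}$ is $$\mathfrak{b}(T)=\{u\in V \mid \langle u,x\rangle\geq 1 \text{ for all } x\in T\}.$$ *)

theory Defs
  imports "HOL-Probability.Probability"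
begin

text \<open>
  Integrability is demanded explicitly wherever an expectation is prescribed, because the Bochner
  integral of a non-integrable function is the junk value 0.
\<close>

definition centered_random_vector ::
    "'b measure \<Rightarrow> ('b \<Rightarrow> 'a::euclidean_space) \<Rightarrow> bool" where
  "centered_random_vector M X \<longleftrightarrow>
     prob_space M \<and> X \<in> borel_measurable M \<and>
     (\<forall>v. integrable M (\<lambda>\<omega>. v \<bullet> X \<omega>) \<and> prob_space.expectation M (\<lambda>\<omega>. v \<bullet> X \<omega>) = 0)"

definition self_adjoint :: "('a::euclidean_space \<Rightarrow> 'a) \<Rightarrow> bool" where
  "self_adjoint S \<longleftrightarrow> linear S \<and> (\<forall>u v. u \<bullet> S v = S u \<bullet> v)"

definition pos_semidef :: "('a::euclidean_space \<Rightarrow> 'a) \<Rightarrow> bool" where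
  "pos_semidef S \<longleftrightarrow> (\<forall>u. u \<bullet> S u \<ge> 0)"

definition pos_def :: "('a::euclidean_space \<Rightarrow> 'a) \<Rightarrow> bool" where
  "pos_def S \<longleftrightarrow> (\<forall>u. u \<noteq> 0 \<longrightarrow> u \<bullet> S u > 0)"

text \<open>
  For a centered random vector the variance of \<open>u \<bullet> X\<close> is its second moment, so finite variance
  is square integrability; this also makes the products \<open>(u \<bullet> X) * (v \<bullet> X)\<close> integrable.
\<close>

definition has_covariance ::
    "'b measure \<Rightarrow> ('b \<Rightarrow> 'a::euclidean_space) \<Rightarrow> ('a \<Rightarrow> 'a) \<Rightarrow> bool" where
  "has_covariance M X S \<longleftrightarrow>
     (\<forall>u. integrable M (\<lambda>\<omega>. (u \<bullet> X \<omega>)\<^sup>2)) \<and>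
     self_adjoint S \<and> pos_semidef S \<and>
     (\<forall>u v. prob_space.expectation M (\<lambda>\<omega>. (u \<bullet> X \<omega>) * (v \<bullet> X \<omega>)) = u \<bullet> S v)"

lemma has_covariance_unique:
  assumes "has_covariance M X S" and "has_covariance M X S'"
  shows "S = S'"
  using assms unfolding has_covariance_def
  by (intro ext) (metis vector_eq_rdot inner_commute)

definition blocker :: "'a::euclidean_space set \<Rightarrow> 'a set" where
  "blocker T = {u. \<forall>x\<in>T. u \<bullet> x \<ge> 1}"

end

theory Submission imports Defs
begin

text \<open>
  If \<open>u\<close> lies in the blocker of \<open>T\<close>, then \<open>X \<in> T\<close> forces the centered scalar variable \<open>u \<bullet> X\<close>
  to be at least 1. Its variance is \<open>s = u \<bullet> S u\<close>, so Cantelli's one-sided form of Chebyshev's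
  inequality bounds the probability of the event by \<open>s / (1 + s)\<close> (\<open>prob_le_of_mem_blocker\<close>).

  For sharpness, the blocker and \<open>T\<close> are in duality: minimizing \<open>u \<bullet> S u\<close> over the blocker of a
  closed convex \<open>T\<close> not containing 0 amounts to minimizing the inverse form \<open>x \<bullet> S\<^sup>-\<^sup>1 x\<close> over \<open>T\<close>,
  and the minima are reciprocal to each other. The minimizer \<open>x0\<close> over \<open>T\<close> yields the minimizer
  \<open>u0 = s S\<^sup>-\<^sup>1 x0\<close> over the blocker, where \<open>s\<close> is the minimum over the blocker
  (\<open>contact_point\<close>). So the infimum of the bounds is \<open>s / (1 + s)\<close>.

  Equality in Cantelli's inequality for \<open>u0 \<bullet> X\<^sub>0\<close> requires it to take the value 1 with probability
  \<open>p = s / (1 + s)\<close> and the value \<open>- s\<close> otherwise. It suffices to concentrate the mass \<open>p\<close> in the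
  single point \<open>x0\<close> of \<open>T\<close> and to put all the remaining randomness into the other event: there the
  vector is \<open>- s x0\<close> plus a centered vector with covariance \<open>(1 + s) (S - s x0 x0\<^sup>T)\<close>. A vector
  with covariance \<open>S - s x0 x0\<^sup>T\<close> need not be built from scratch: it is the projection
  \<open>X - (u0 \<bullet> X) x0\<close> of the given vector along \<open>x0\<close> (\<open>exists_covariance_with_atom\<close>).
\<close>

section \<open>The upper bound\<close>

text \<open>
  The parabola \<open>((y + s) / (1 + s))\<^sup>2\<close> dominates the indicator of \<open>y \<ge> 1\<close> and touches it at \<open>y = 1\<close>
  and at \<open>y = - s\<close>, the two values of the extremal distribution. Integrate this domination.
\<close>

lemma (in prob_space) Cantelli_inequality:
  fixes Y :: "'a \<Rightarrow> real"
  assumes int: "integrable M Y" and int2: "integrable M (\<lambda>\<omega>. (Y \<omega>)\<^sup>2)"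
    and mean: "expectation Y = 0"
  defines "s \<equiv> expectation (\<lambda>\<omega>. (Y \<omega>)\<^sup>2)"
  shows "\<P>(\<omega> in M. 1 \<le> Y \<omega>) \<le> s / (1 + s)"
proof -
  have s0: "0 \<le> s" by (simp add: s_def)
  have [measurable]: "Y \<in> borel_measurable M" using int by auto
  let ?A = "{\<omega> \<in> space M. 1 \<le> Y \<omega>}"
  have A: "?A \<in> events" by measurable
  let ?g = "\<lambda>\<omega>. ((Y \<omega>)\<^sup>2 + 2 * s * Y \<omega> + s\<^sup>2) / (1 + s)\<^sup>2"
  have "prob ?A = expectation (indicator ?A)" using A by simp
  also have "\<dots> \<le> expectation ?g"
  proof (rule integral_mono)
    show "integrable M (indicator ?A :: 'a \<Rightarrow> real)"
      using A by (simp add: integrable_indicator_iff emeasure_eq_measure)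
    show "integrable M ?g" using int int2 by simp
    fix \<omega>
    have sq: "?g \<omega> = ((Y \<omega> + s) / (1 + s))\<^sup>2"
      by (simp add: power_divide power2_sum algebra_simps)
    show "indicator ?A \<omega> \<le> ?g \<omega>"
    proof (cases "1 \<le> Y \<omega>")
      case True
      then have "1 \<le> (Y \<omega> + s) / (1 + s)" using s0 by (simp add: field_simps)
      then have "1 \<le> ((Y \<omega> + s) / (1 + s))\<^sup>2" by (rule one_le_power)
      then show ?thesis unfolding sq by (simp add: indicator_def)
    next
      case False
      then show ?thesis unfolding sq by (simp add: indicator_def)
    qed
  qed
  also have "\<dots> = (s + s\<^sup>2) / (1 + s)\<^sup>2"
    using int int2 mean by (simp add: s_def prob_space)
  also have "\<dots> = s / (1 + s)"
  proof -
    have "s + s\<^sup>2 = s * (1 + s)" by (simp add: power2_eq_square algebra_simps)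
    then show ?thesis using s0 by (simp add: power2_eq_square)
  qed
  finally show ?thesis .
qed

lemma prob_le_of_mem_blocker:
  assumes X: "centered_random_vector M X" and cov: "has_covariance M X S"
    and u: "u \<in> blocker T"
  shows "\<P>(\<omega> in M. X \<omega> \<in> T) \<le> (u \<bullet> S u) / (1 + u \<bullet> S u)"
proof -
  interpret prob_space M using X by (simp add: centered_random_vector_def)
  have [measurable]: "X \<in> borel_measurable M" using X by (simp add: centered_random_vector_def)
  have "\<P>(\<omega> in M. X \<omega> \<in> T) \<le> \<P>(\<omega> in M. 1 \<le> u \<bullet> X \<omega>)"
    using u by (intro finite_measure_mono) (auto simp: blocker_def)
  also have "\<dots> \<le> (u \<bullet> S u) / (1 + u \<bullet> S u)"
    using Cantelli_inequality[of "\<lambda>\<omega>. u \<bullet> X \<omega>"] X cov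
    by (simp add: centered_random_vector_def has_covariance_def power2_eq_square)
  finally show ?thesis .
qed

lemma odds_ratio_mono:
  fixes s t :: real
  assumes "0 \<le> s" "s \<le> t"
  shows "s / (1 + s) \<le> t / (1 + t)"
  using assms by (simp add: field_simps)

section \<open>The contact point of a closed convex set\<close>

text \<open>
  The constant is the minimum of the quadratic form on the unit sphere, which is compact. The bound
  makes the sublevel sets of the form bounded, which provides minimizers on unbounded closed sets.
\<close>
lemma pos_def_coercive:
  fixes S :: "'a::euclidean_space \<Rightarrow> 'a"
  assumes lin: "linear S" and pd: "pos_def S"
  obtains m where "0 < m" "\<And>w. m * (norm w)\<^sup>2 \<le> w \<bullet> S w"
proof -
  have cont: "continuous_on (sphere 0 1) (\<lambda>w. w \<bullet> S w)"
    using lin by (intro continuous_intros linear_continuous_on) (simp add: linear_conv_bounded_linear)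
  obtain z :: 'a where z: "z \<in> sphere 0 1" "\<And>w. w \<in> sphere 0 1 \<Longrightarrow> z \<bullet> S z \<le> w \<bullet> S w"
    using continuous_attains_inf[OF _ _ cont] by auto
  have "z \<noteq> 0" using z(1) by auto
  then have "0 < z \<bullet> S z" using pd by (simp add: pos_def_def)
  moreover have "(z \<bullet> S z) * (norm w)\<^sup>2 \<le> w \<bullet> S w" for w
  proof (cases "w = 0")
    case True
    then show ?thesis by (simp add: linear_0[OF lin])
  next
    case False
    have "z \<bullet> S z \<le> (w /\<^sub>R norm w) \<bullet> S (w /\<^sub>R norm w)"
      using False by (intro z(2)) simp
    also have "\<dots> = (w \<bullet> S w) / (norm w)\<^sup>2"
      by (simp add: linear_cmul[OF lin] power2_eq_square divide_inverse)
    finally show ?thesis using False by (simp add: field_simps)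
  qed
  ultimately show ?thesis using that by blast
qed

lemma pos_def_quadratic_attains_min:
  fixes S :: "'a::euclidean_space \<Rightarrow> 'a"
  assumes lin: "linear S" and pd: "pos_def S" and W: "closed W" "W \<noteq> {}"
  obtains w0 where "w0 \<in> W" "\<And>w. w \<in> W \<Longrightarrow> w0 \<bullet> S w0 \<le> w \<bullet> S w"
proof -
  obtain a where a: "a \<in> W" using W by blast
  obtain m where m: "0 < m" "\<And>w. m * (norm w)\<^sup>2 \<le> w \<bullet> S w"
    using pos_def_coercive[OF lin pd] by blast
  let ?K = "W \<inter> {w. w \<bullet> S w \<le> a \<bullet> S a}"
  have cont: "continuous_on A (\<lambda>w. w \<bullet> S w)" for A
    using lin by (intro continuous_intros linear_continuous_on) (simp add: linear_conv_bounded_linear)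
  have "norm w \<le> sqrt ((a \<bullet> S a) / m)" if "w \<in> ?K" for w
  proof -
    have "m * (norm w)\<^sup>2 \<le> a \<bullet> S a" using that m(2)[of w] by simp
    then show ?thesis using m(1) by (intro real_le_rsqrt) (simp add: field_simps)
  qed
  then have "bounded ?K" unfolding bounded_iff by blast
  moreover have "closed ?K"
    using W(1) by (intro closed_Int closed_Collect_le cont continuous_on_const)
  ultimately have "compact ?K" by (simp add: compact_eq_bounded_closed)
  moreover have "?K \<noteq> {}" using a by auto
  ultimately obtain w0 where w0: "w0 \<in> ?K" "\<And>w. w \<in> ?K \<Longrightarrow> w0 \<bullet> S w0 \<le> w \<bullet> S w"
    using continuous_attains_inf[OF _ _ cont] by meson
  have "w0 \<bullet> S w0 \<le> w \<bullet> S w" if "w \<in> W" for w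
    using w0(1) w0(2)[of w] that by (cases "w \<bullet> S w \<le> a \<bullet> S a") auto
  with w0(1) that show ?thesis by blast
qed

text \<open>
  The first-order optimality condition: on the segment from \<open>w0\<close> to \<open>w\<close>, which stays in \<open>W\<close>, the form
  is a quadratic polynomial whose derivative at \<open>w0\<close> cannot be negative.
\<close>
lemma quadratic_min_variational:
  fixes S :: "'a::euclidean_space \<Rightarrow> 'a"
  assumes sa: "self_adjoint S" and W: "convex W" "w0 \<in> W"
    and min: "\<And>w. w \<in> W \<Longrightarrow> w0 \<bullet> S w0 \<le> w \<bullet> S w" and w: "w \<in> W"
  shows "w0 \<bullet> S w0 \<le> w0 \<bullet> S w"
proof (rule ccontr)
  assume neg: "\<not> ?thesis"
  have lin: "linear S" and sym: "\<And>u v. u \<bullet> S v = S u \<bullet> v"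
    using sa by (auto simp: self_adjoint_def)
  define d where "d = w - w0"
  define a where "a = - (w0 \<bullet> S d)"
  define q where "q = d \<bullet> S d"
  have a: "0 < a" using neg by (simp add: a_def d_def linear_diff[OF lin] inner_diff_right)
  have step: "0 \<le> - 2 * t * a + t\<^sup>2 * q" if t: "0 \<le> t" "t \<le> 1" for t
  proof -
    have "w0 + t *\<^sub>R d = (1 - t) *\<^sub>R w0 + t *\<^sub>R w" by (simp add: d_def algebra_simps)
    then have "w0 + t *\<^sub>R d \<in> W" using W w t by (simp add: convexD)
    then have "w0 \<bullet> S w0 \<le> (w0 + t *\<^sub>R d) \<bullet> S (w0 + t *\<^sub>R d)" by (rule min)
    also have "\<dots> = w0 \<bullet> S w0 - 2 * t * a + t\<^sup>2 * q"
      using sym[of d w0] by (simp add: linear_add[OF lin] linear_cmul[OF lin] inner_commute[of "S d"] a_def q_def power2_eq_square algebra_simps)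
    finally show ?thesis by simp
  qed
  \<comment> \<open>A step so short that the quadratic term eats up at most half of the linear gain \<open>2 * t * a\<close>.\<close>
  define t where "t = a / (a + \<bar>q\<bar>)"
  have t: "0 < t" "t \<le> 1" using a by (auto simp: t_def)
  have "t * q \<le> t * (a + \<bar>q\<bar>)" using t a by (intro mult_left_mono) auto
  also have "\<dots> = a" using a by (simp add: t_def)
  finally have "t * (t * q) \<le> t * a" using t(1) by (intro mult_left_mono) auto
  moreover have "0 < t * a" using t a by simp
  ultimately show False using step[of t] t a by (simp add: power2_eq_square algebra_simps)
qed

text \<open>
  Substituting \<open>x = S w\<close> turns the inverse form \<open>x \<bullet> S\<^sup>-\<^sup>1 x\<close> on \<open>T\<close> into \<open>w \<bullet> S w\<close> on the preimage
  of \<open>T\<close>, so that the inverse of \<open>S\<close> is never mentioned. If \<open>w0\<close> is the minimizer there and \<open>q\<close> the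
  minimum, then \<open>x0 = S w0\<close>, \<open>u0 = w0 / q\<close> and \<open>s = 1 / q\<close>. The variational inequality at \<open>w0\<close> says
  that the hyperplane \<open>u0 \<bullet> x = 1\<close> supports \<open>T\<close> at \<open>x0\<close>, that is, \<open>u0\<close> is in the blocker.
\<close>
lemma contact_point:
  fixes S :: "'a::euclidean_space \<Rightarrow> 'a"
  assumes sa: "self_adjoint S" and pd: "pos_def S"
    and T: "closed T" "convex T" "T \<noteq> {}" "0 \<notin> T"
  obtains s x0 u0 where "0 < s" "x0 \<in> T" "u0 \<in> blocker T" "S u0 = s *\<^sub>R x0" "u0 \<bullet> x0 = 1"
    "\<And>u. u \<in> blocker T \<Longrightarrow> s \<le> u \<bullet> S u"
proof -
  have lin: "linear S" and sym: "\<And>u v. u \<bullet> S v = S u \<bullet> v"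
    using sa by (auto simp: self_adjoint_def)
  have "inj S"
    unfolding linear_injective_0[OF lin] using pd by (force simp: pos_def_def)
  then have surj: "surj S" by (rule linear_inj_imp_surj[OF lin])
  let ?W = "S -` T"
  have "closed ?W"
    using T(1) lin by (intro continuous_closed_vimage linear_continuous_at)
      (auto simp: linear_conv_bounded_linear)
  moreover have "?W \<noteq> {}" using T(3) surj by (metis ex_in_conv surjD vimageI2)
  ultimately obtain w0 where w0: "w0 \<in> ?W" "\<And>w. w \<in> ?W \<Longrightarrow> w0 \<bullet> S w0 \<le> w \<bullet> S w"
    using pos_def_quadratic_attains_min[OF lin pd] by blast
  define q where "q = w0 \<bullet> S w0"
  have "w0 \<noteq> 0" using w0(1) T(4) linear_0[OF lin] by auto
  then have q: "0 < q" using pd by (simp add: q_def pos_def_def)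
  have "convex ?W" using T(2) lin by (simp add: convex_linear_vimage)
  then have var: "q \<le> w0 \<bullet> S w" if "S w \<in> T" for w
    unfolding q_def using quadratic_min_variational[OF sa _ w0] that by simp
  have blk: "w0 /\<^sub>R q \<in> blocker T"
    unfolding blocker_def
  proof (intro CollectI ballI)
    fix x assume "x \<in> T"
    moreover obtain w where "x = S w" using surj by (metis surjD)
    ultimately show "1 \<le> (w0 /\<^sub>R q) \<bullet> x" using var[of w] q by (simp add: field_simps)
  qed
  have opt: "1 / q \<le> u \<bullet> S u" if "u \<in> blocker T" for u
  proof -
    have *: "1 \<le> u \<bullet> S w0" using that w0(1) by (auto simp: blocker_def)
    have eq: "w0 \<bullet> S u = u \<bullet> S w0" using sym[of w0 u] by (simp add: inner_commute)
    \<comment> \<open>The Cauchy--Schwarz inequality for the form \<open>S\<close>, in the shape of the square behind it.\<close>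
    have "0 \<le> (u - w0 /\<^sub>R q) \<bullet> S (u - w0 /\<^sub>R q)"
      using pd linear_0[OF lin] by (cases "u - w0 /\<^sub>R q = 0") (force simp: pos_def_def less_imp_le)+
    also have "\<dots> = u \<bullet> S u - 2 * (u \<bullet> S w0) / q + 1 / q"
      using q by (simp add: linear_diff[OF lin] linear_cmul[OF lin] inner_diff_left inner_diff_right
          eq q_def[symmetric] field_simps)
    finally have "0 \<le> u \<bullet> S u - 2 * (u \<bullet> S w0) / q + 1 / q" .
    moreover have "1 / q \<le> (u \<bullet> S w0) / q" using * q by (intro divide_right_mono) auto
    ultimately show ?thesis by (simp add: field_simps)
  qed
  show ?thesis
  proof (rule that[of "1 / q" "S w0" "w0 /\<^sub>R q"])
    show "S (w0 /\<^sub>R q) = (1 / q) *\<^sub>R S w0" by (simp add: linear_cmul[OF lin] divide_inverse)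
    show "(w0 /\<^sub>R q) \<bullet> S w0 = 1" using q by (simp add: q_def[symmetric])
  qed (use q w0 blk opt in auto)
qed

section \<open>The extremal distribution\<close>

text \<open>
  The mixture of the point mass at \<open>x\<close>, with weight \<open>p\<close>, and the distribution of \<open>Y\<close>. It is realized
  by an independent coin toss that decides between the two, so that Fubini's theorem computes its
  integrals.
\<close>
definition atom_mixture ::
    "real \<Rightarrow> 'a::euclidean_space \<Rightarrow> 'b measure \<Rightarrow> ('b \<Rightarrow> 'a) \<Rightarrow> 'a measure" where
  "atom_mixture p x M Y =
     distr (measure_pmf (bernoulli_pmf p) \<Otimes>\<^sub>M M) borel (\<lambda>(c, \<omega>). if c then x else Y \<omega>)"

lemma measurable_atom_mixture:
  fixes Y :: "'b \<Rightarrow> 'a::euclidean_space"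
  assumes [measurable]: "Y \<in> borel_measurable M"
  shows "(\<lambda>(c, \<omega>). if c then x else Y \<omega>) \<in> borel_measurable (measure_pmf (bernoulli_pmf p) \<Otimes>\<^sub>M M)"
  by measurable

lemma prob_space_atom_mixture:
  assumes "prob_space M" "Y \<in> borel_measurable M"
  shows "prob_space (atom_mixture p x M Y)"
proof -
  interpret M: prob_space M by fact
  interpret pair_prob_space "measure_pmf (bernoulli_pmf p)" M ..
  show ?thesis unfolding atom_mixture_def
    using assms(2) by (intro prob_space_distr measurable_atom_mixture)
qed

lemma atom_mixture_integral:
  fixes g :: "'a::euclidean_space \<Rightarrow> real"
  assumes "prob_space M" and Y[measurable]: "Y \<in> borel_measurable M"
    and p: "0 \<le> p" "p \<le> 1"
    and g[measurable]: "g \<in> borel_measurable borel"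
    and int: "integrable M (\<lambda>\<omega>. g (Y \<omega>))"
  shows "integrable (atom_mixture p x M Y) g"
    and "integral\<^sup>L (atom_mixture p x M Y) g = p * g x + (1 - p) * (\<integral>\<omega>. g (Y \<omega>) \<partial>M)"
proof -
  interpret M: prob_space M by fact
  let ?B = "measure_pmf (bernoulli_pmf p)"
  interpret pair_prob_space ?B M ..
  let ?h = "\<lambda>z. g (case z of (c, \<omega>) \<Rightarrow> if c then x else Y \<omega>)"
  have h: "integrable (?B \<Otimes>\<^sub>M M) ?h"
  proof (rule Fubini_integrable)
    show "?h \<in> borel_measurable (?B \<Otimes>\<^sub>M M)"
      using measurable_atom_mixture[OF Y] by measurable
    show "integrable ?B (\<lambda>c. \<integral>\<omega>. norm (?h (c, \<omega>)) \<partial>M)"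
      by (rule integrable_measure_pmf_finite) simp
    have "integrable M (\<lambda>\<omega>. ?h (c, \<omega>))" for c using int by (cases c) auto
    then show "AE c in ?B. integrable M (\<lambda>\<omega>. ?h (c, \<omega>))" by simp
  qed
  show "integrable (atom_mixture p x M Y) g"
    unfolding atom_mixture_def by (subst integrable_distr_eq[OF measurable_atom_mixture[OF Y] g]) (rule h)
  have "integral\<^sup>L (atom_mixture p x M Y) g = integral\<^sup>L (?B \<Otimes>\<^sub>M M) ?h"
    unfolding atom_mixture_def by (rule integral_distr[OF measurable_atom_mixture[OF Y] g])
  also have "\<dots> = (\<integral>c. \<integral>\<omega>. ?h (c, \<omega>) \<partial>M \<partial>?B)" using integral_fst'[OF h] by simp
  also have "\<dots> = p * g x + (1 - p) * (\<integral>\<omega>. g (Y \<omega>) \<partial>M)"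
    using p by (simp add: M.prob_space)
  finally show "integral\<^sup>L (atom_mixture p x M Y) g = p * g x + (1 - p) * (\<integral>\<omega>. g (Y \<omega>) \<partial>M)" .
qed

text \<open>By polarization, since only squares are integrable by definition.\<close>
lemma has_covariance_integrable_mult:
  assumes "centered_random_vector M X" and "has_covariance M X S"
  shows "integrable M (\<lambda>\<omega>. (u \<bullet> X \<omega>) * (v \<bullet> X \<omega>))"
proof -
  have sq: "integrable M (\<lambda>\<omega>. (w \<bullet> X \<omega>)\<^sup>2)" for w
    using assms(2) by (simp add: has_covariance_def)
  have polarization: "(u \<bullet> x) * (v \<bullet> x) = (((u + v) \<bullet> x)\<^sup>2 - (u \<bullet> x)\<^sup>2 - (v \<bullet> x)\<^sup>2) / 2" for x :: 'b
    by (simp add: inner_add_left power2_sum)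
  show ?thesis unfolding polarization using sq by simp
qed

text \<open>
  The mixture of the point mass at \<open>x0\<close> with weight \<open>p = s / (1 + s)\<close> and of the vector
  \<open>Y = - s x0 + sqrt (1 + s) (X - (u0 \<bullet> X) x0)\<close>. Since \<open>p = s (1 - p)\<close>, it is centered. The
  hypothesis \<open>S u0 = s x0\<close> says that the component \<open>(u0 \<bullet> X) x0\<close> of \<open>X\<close> is uncorrelated with the
  rest, so the rest has covariance \<open>S - s x0 x0\<^sup>T\<close>; scaling by \<open>1 + s = 1 / (1 - p)\<close> makes up for
  its being present only with probability \<open>1 - p\<close>, and the two values \<open>x0\<close> and \<open>- s x0\<close> contribute
  \<open>(p + s\<^sup>2 (1 - p)) x0 x0\<^sup>T = s x0 x0\<^sup>T\<close>.
\<close>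
lemma exists_covariance_with_atom:
  fixes X :: "'b \<Rightarrow> 'a::euclidean_space"
  assumes X: "centered_random_vector M X" and cov: "has_covariance M X S"
    and s: "0 < s" and Su: "S u0 = s *\<^sub>R x0" and ux: "u0 \<bullet> x0 = 1"
  obtains N :: "'a measure" where "centered_random_vector N (\<lambda>x. x)" "has_covariance N (\<lambda>x. x) S"
    "\<And>T. T \<in> sets borel \<Longrightarrow> x0 \<in> T \<Longrightarrow> s / (1 + s) \<le> \<P>(x in N. x \<in> T)"
proof -
  interpret M: prob_space M using X by (simp add: centered_random_vector_def)
  have Xm[measurable]: "X \<in> borel_measurable M" using X by (simp add: centered_random_vector_def)
  have sa: "self_adjoint S" "pos_semidef S" using cov by (auto simp: has_covariance_def)
  then have lin: "linear S" and sym: "\<And>u v. u \<bullet> S v = S u \<bullet> v" by (auto simp: self_adjoint_def)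
  define p where "p = s / (1 + s)"
  have p: "0 \<le> p" "p \<le> 1" "1 - p = 1 / (1 + s)" using s by (auto simp: p_def field_simps)
  define Y where "Y \<omega> = (- s) *\<^sub>R x0 + sqrt (1 + s) *\<^sub>R (X \<omega> - (u0 \<bullet> X \<omega>) *\<^sub>R x0)" for \<omega>
  have Ym[measurable]: "Y \<in> borel_measurable M" unfolding Y_def by measurable
  \<comment> \<open>The adjoint of the projection \<open>x \<mapsto> x - (u0 \<bullet> x) x0\<close>: it reduces moments of \<open>Y\<close> to moments of \<open>X\<close>.\<close>
  define \<pi> where "\<pi> v = v - (v \<bullet> x0) *\<^sub>R u0" for v
  have vY: "v \<bullet> Y \<omega> = - s * (v \<bullet> x0) + sqrt (1 + s) * (\<pi> v \<bullet> X \<omega>)" for v \<omega>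
    by (simp add: Y_def \<pi>_def inner_add_right inner_diff_right inner_diff_left algebra_simps)
  have i1: "integrable M (\<lambda>\<omega>. v \<bullet> X \<omega>)" and e1: "M.expectation (\<lambda>\<omega>. v \<bullet> X \<omega>) = 0" for v
    using X by (auto simp: centered_random_vector_def)
  note i2 = has_covariance_integrable_mult[OF X cov]
  have e2: "M.expectation (\<lambda>\<omega>. (u \<bullet> X \<omega>) * (v \<bullet> X \<omega>)) = u \<bullet> S v" for u v
    using cov by (simp add: has_covariance_def)
  have S\<pi>: "\<pi> u \<bullet> S (\<pi> v) = u \<bullet> S v - s * (u \<bullet> x0) * (v \<bullet> x0)" for u v
  proof -
    have "u0 \<bullet> S v = s * (v \<bullet> x0)" by (simp add: sym Su inner_commute)
    then show ?thesis
      by (simp add: \<pi>_def linear_diff[OF lin] linear_cmul[OF lin] Su inner_diff_left inner_diff_right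
          ux algebra_simps)
  qed
  have iY: "integrable M (\<lambda>\<omega>. v \<bullet> Y \<omega>)" for v
    unfolding vY using i1 by simp
  have eY: "M.expectation (\<lambda>\<omega>. v \<bullet> Y \<omega>) = - s * (v \<bullet> x0)" for v
    unfolding vY using i1 e1 by (simp add: M.prob_space)
  have prodY: "(u \<bullet> Y \<omega>) * (v \<bullet> Y \<omega>) = s\<^sup>2 * (u \<bullet> x0) * (v \<bullet> x0)
      - (s * (u \<bullet> x0) * sqrt (1 + s)) * (\<pi> v \<bullet> X \<omega>) - (s * (v \<bullet> x0) * sqrt (1 + s)) * (\<pi> u \<bullet> X \<omega>)
      + (1 + s) * ((\<pi> u \<bullet> X \<omega>) * (\<pi> v \<bullet> X \<omega>))" for u v \<omega>
  proof -
    have expand: "(- s * a + r * c) * (- s * b + r * d) =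
        s\<^sup>2 * a * b - (s * a * r) * d - (s * b * r) * c + r\<^sup>2 * (c * d)" for a b c d r :: real
      by (simp add: power2_eq_square algebra_simps)
    show ?thesis unfolding vY expand using s by simp
  qed
  have iYY: "integrable M (\<lambda>\<omega>. (u \<bullet> Y \<omega>) * (v \<bullet> Y \<omega>))" for u v
    unfolding prodY using i1 i2 by simp
  have eYY: "M.expectation (\<lambda>\<omega>. (u \<bullet> Y \<omega>) * (v \<bullet> Y \<omega>)) =
      s\<^sup>2 * (u \<bullet> x0) * (v \<bullet> x0) + (1 + s) * (u \<bullet> S v - s * (u \<bullet> x0) * (v \<bullet> x0))" for u v
    unfolding prodY using i1 i2 by (simp add: M.prob_space e1 e2 S\<pi>)
  define N where "N = atom_mixture p x0 M Y"
  have setsN: "sets N = sets borel" "space N = UNIV" by (simp_all add: N_def atom_mixture_def)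
  note mix = atom_mixture_integral[OF M.prob_space_axioms Ym p(1,2), of _ x0, folded N_def]
  have probN: "prob_space N" unfolding N_def
    using Ym M.prob_space_axioms by (rule prob_space_atom_mixture[rotated])
  have cent: "centered_random_vector N (\<lambda>x. x)"
    unfolding centered_random_vector_def
  proof (intro conjI allI)
    show "(\<lambda>x. x) \<in> borel_measurable N" by (simp add: measurable_def setsN space_borel)
    fix v :: 'a
    show "integrable N (\<lambda>x. v \<bullet> x)" by (rule mix(1)) (use iY in auto)
    have "integral\<^sup>L N (\<lambda>x. v \<bullet> x) = p * (v \<bullet> x0) + (1 - p) * (- s * (v \<bullet> x0))"
      by (subst mix(2)) (use iY eY in auto)
    also have "\<dots> = 0" using s by (simp add: p(3)) (simp add: p_def)
    finally show "integral\<^sup>L N (\<lambda>x. v \<bullet> x) = 0" .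
  qed (rule probN)
  have covN: "has_covariance N (\<lambda>x. x) S"
    unfolding has_covariance_def
  proof (intro conjI allI)
    fix u v :: 'a
    show "integrable N (\<lambda>x. (u \<bullet> x)\<^sup>2)"
      by (rule mix(1)) (use iYY[of u u] in \<open>auto simp: power2_eq_square\<close>)
    have "integral\<^sup>L N (\<lambda>x. (u \<bullet> x) * (v \<bullet> x)) = p * ((u \<bullet> x0) * (v \<bullet> x0)) + (1 - p) *
        (s\<^sup>2 * (u \<bullet> x0) * (v \<bullet> x0) + (1 + s) * (u \<bullet> S v - s * (u \<bullet> x0) * (v \<bullet> x0)))"
      by (subst mix(2)) (use iYY eYY in auto)
    also have "\<dots> = (1 + s) * (u \<bullet> S v) / (1 + s)"
      unfolding p(3) unfolding p_def times_divide_eq_left add_divide_distrib[symmetric]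
      by (rule arg_cong[where f = "\<lambda>a. a / (1 + s)"]) (simp add: power2_eq_square algebra_simps)
    also have "\<dots> = u \<bullet> S v" using s by simp
    finally show "integral\<^sup>L N (\<lambda>x. (u \<bullet> x) * (v \<bullet> x)) = u \<bullet> S v" .
  qed (use sa in auto)
  have "s / (1 + s) \<le> \<P>(x in N. x \<in> T)" if T[measurable]: "T \<in> sets borel" and x0: "x0 \<in> T" for T
  proof -
    have "integrable M (\<lambda>\<omega>. indicator T (Y \<omega>) :: real)"
      by (rule M.integrable_const_bound[where B = 1]) auto
    then have "integral\<^sup>L N (indicator T) = p * indicator T x0 + (1 - p) * (\<integral>\<omega>. indicator T (Y \<omega>) \<partial>M)"
      by (intro mix(2)) auto
    moreover have "0 \<le> (1 - p) * (\<integral>\<omega>. indicator T (Y \<omega>) \<partial>M)"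
      using p(2) by (intro mult_nonneg_nonneg integral_nonneg) simp_all
    ultimately show ?thesis using x0 T by (simp add: p_def setsN)
  qed
  with cent covN that show ?thesis by blast
qed

theorem theorem2:
  fixes M :: "'b measure"
    and X :: "'b \<Rightarrow> 'a::euclidean_space"
    and \<Sigma> :: "'a \<Rightarrow> 'a"
    and T :: "'a set"
    and b :: 'a
  assumes "centered_random_vector M X"
    and "has_covariance M X \<Sigma>"
    and "pos_def \<Sigma>"
    and "T \<noteq> {}"
    and "T \<in> sets borel"
    and "b \<noteq> 0"
  shows "(\<forall>u\<in>blocker T. \<P>(\<omega> in M. X \<omega> \<in> T) \<le> (u \<bullet> \<Sigma> u) / (1 + u \<bullet> \<Sigma> u)) \<and>
    (blocker T \<noteq> {} \<longrightarrow>
      \<P>(\<omega> in M. X \<omega> \<in> T) \<le> (INF u\<in>blocker T. (u \<bullet> \<Sigma> u) / (1 + u \<bullet> \<Sigma> u))) \<and>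
    (closed T \<and> convex T \<and> 0 \<notin> T \<longrightarrow>
      (\<exists>(M\<^sub>0 :: 'a measure) (X\<^sub>0 :: 'a \<Rightarrow> 'a).
        centered_random_vector M\<^sub>0 X\<^sub>0 \<and> has_covariance M\<^sub>0 X\<^sub>0 \<Sigma> \<and>
        \<P>(\<omega> in M\<^sub>0. X\<^sub>0 \<omega> \<in> T) = (INF u\<in>blocker T. (u \<bullet> \<Sigma> u) / (1 + u \<bullet> \<Sigma> u))))"
proof (intro conjI impI)
  note X = assms(1,2)
  show bound: "\<forall>u\<in>blocker T. \<P>(\<omega> in M. X \<omega> \<in> T) \<le> (u \<bullet> \<Sigma> u) / (1 + u \<bullet> \<Sigma> u)"
    using prob_le_of_mem_blocker[OF X] by blast
  show "\<P>(\<omega> in M. X \<omega> \<in> T) \<le> (INF u\<in>blocker T. (u \<bullet> \<Sigma> u) / (1 + u \<bullet> \<Sigma> u))"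
    if "blocker T \<noteq> {}"
    using that bound by (intro cINF_greatest) auto
  show "\<exists>(M\<^sub>0 :: 'a measure) (X\<^sub>0 :: 'a \<Rightarrow> 'a).
      centered_random_vector M\<^sub>0 X\<^sub>0 \<and> has_covariance M\<^sub>0 X\<^sub>0 \<Sigma> \<and>
      \<P>(\<omega> in M\<^sub>0. X\<^sub>0 \<omega> \<in> T) = (INF u\<in>blocker T. (u \<bullet> \<Sigma> u) / (1 + u \<bullet> \<Sigma> u))"
    if T: "closed T \<and> convex T \<and> 0 \<notin> T"
  proof -
    have sa: "self_adjoint \<Sigma>" using assms(2) by (simp add: has_covariance_def)
    obtain s x0 u0 where s: "0 < s" "x0 \<in> T" and u0: "u0 \<in> blocker T" "\<Sigma> u0 = s *\<^sub>R x0" "u0 \<bullet> x0 = 1"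
      and opt: "\<And>u. u \<in> blocker T \<Longrightarrow> s \<le> u \<bullet> \<Sigma> u"
      using contact_point[OF sa assms(3), of T] T assms(4) by metis
    obtain N :: "'a measure" where N: "centered_random_vector N (\<lambda>x. x)" "has_covariance N (\<lambda>x. x) \<Sigma>"
      and atom: "s / (1 + s) \<le> \<P>(x in N. x \<in> T)"
      using exists_covariance_with_atom[OF X s(1) u0(2,3)] assms(5) s(2) by metis
    have us: "u0 \<bullet> \<Sigma> u0 = s" using u0 by simp
    have "(INF u\<in>blocker T. (u \<bullet> \<Sigma> u) / (1 + u \<bullet> \<Sigma> u)) = s / (1 + s)"
      using u0(1) us opt s(1)
      by (intro cInf_eq_minimum) (force intro: odds_ratio_mono)+
    \<comment> \<open>The general bound applies to the new vector, whose covariance is the same.\<close>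
    moreover have "\<P>(x in N. x \<in> T) \<le> s / (1 + s)"
      using prob_le_of_mem_blocker[OF N u0(1)] us by simp
    ultimately have "\<P>(x in N. x \<in> T) = (INF u\<in>blocker T. (u \<bullet> \<Sigma> u) / (1 + u \<bullet> \<Sigma> u))"
      using atom by simp
    with N show ?thesis by blast
  qed
qed

end
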